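(* Let $\vec d=(d_1,\dots,d_q)\in\mathbb N^q$ and $N=d_1\cdots d_q$, and let $\mathrm{orb}(\vec d)$ denote the number of orbits of the action of $(\mathbb Z/N\mathbb Z)^\times$ on $J_{d_1}\times\cdots\times J_{d_q}$. Then \[ \mathrm{orb}(\vec d)=\frac{\prod_{i=1}^q\tilde\varphi(d_i)}{\tilde\varphi(\mathrm{lcm}(d_1,\dots,d_q))}\times 2^{\tilde\beta_0(\Gamma(V_{\vec d}))}. \]
   Context: For $d\in\mathbb N$, $J_1=J_2=\{1\}$ and $J_d=\{j\in\mathbb N:j<d/2,\ \gcd(j,d)=1\}$ for $d\ge3$; for $d\ge3$, $J_d$ is regarded as a set of representatives of $(\mathbb Z/d\mathbb Z)^\times$ modulo the identification $k\sim -k$. $\tilde\varphi(d)=\varphi(d)/2$ for $d\ge3$ and $\tilde\varphi(1)=\tilde\varphi(2)=1$, where $\varphi$ is Euler's function (so $|J_d|=\tilde\varphi(d)$). The group $(\mathbb Z/N\mathbb Z)^\times$ acts on $J_{d_1}\times\cdots\times J_{d_q}$ componentwise by $a\cdot(j_1,\dots,j_q)=(aj_1,\dots,aj_q)$, where $aj_i$ is reduced modulo $d_i$ and replaced by its representative in $J_{d_i}$ modulo $\pm$ (for $d_i\in\{1,2\}$ the component is $1$ and stays fixed). Let $V_{\vec d}=\{j\in\{1,\dots,q\}: d_j\ge3\}$ and let $\Gamma(V_{\vec d})$ be the graph with vertex set $V_{\vec d}$ and an edge between distinct $i,j$ whenever $\gcd(d_i,d_j)\ge3$. $\tilde\beta_0(\Gamma)$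 is the reduced $0$th Betti number, i.e. the number of connected components minus one, with the convention $\tilde\beta_0(\Gamma(\emptyset))=0$. *)

theory Defs
  imports "HOL-Algebra.Algebra" "HOL-Number_Theory.Number_Theory"
begin

text \<open>For \<open>d \<ge> 3\<close> the condition \<open>coprime j d\<close> excludes \<open>j = 0\<close>.
  The index \<open>d = 0\<close> is not used.\<close>

definition J_set :: "nat \<Rightarrow> nat set" where
  "J_set d = (if d \<le> 2 then {1} else {j. 2 * j < d \<and> coprime j d})"

definition totient_tilde :: "nat \<Rightarrow> real" where
  "totient_tilde d = (if d \<le> 2 then 1 else real (totient d) / 2)"

definition pm_rep :: "nat \<Rightarrow> int \<Rightarrow> nat" where
  "pm_rep d k =
    (THE r. r \<in> J_set d \<and> ([k = int r] (mod int d) \<or> [k = - int r] (mod int d)))"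

definition J_tuples :: "nat \<Rightarrow> (nat \<Rightarrow> nat) \<Rightarrow> (nat \<Rightarrow> nat) set" where
  "J_tuples q d = (\<Pi>\<^sub>E i\<in>{1..q}. J_set (d i))"

definition mod_units :: "nat \<Rightarrow> int set monoid" where
  "mod_units N = units_of (ZFact (int N))"

text \<open>The elements of \<open>ZFact (int N)\<close> are residue classes, i.e. sets of integers;
  the action does not depend on the chosen integer \<open>a \<in> A\<close>,
  see \<open>unit_act_apply\<close> below.\<close>

definition unit_act ::
  "nat \<Rightarrow> (nat \<Rightarrow> nat) \<Rightarrow> int set \<Rightarrow> (nat \<Rightarrow> nat) \<Rightarrow> (nat \<Rightarrow> nat)" where
  "unit_act q d A =
    (\<lambda>j\<in>J_tuples q d. \<lambda>i\<in>{1..q}. pm_rep (d i) ((SOME a. a \<in> A) * int (j i)))"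

definition orb :: "nat \<Rightarrow> (nat \<Rightarrow> nat) \<Rightarrow> nat" where
  "orb q d = card (orbits (mod_units (\<Prod>i=1..q. d i)) (J_tuples q d) (unit_act q d))"

definition graph_verts :: "nat \<Rightarrow> (nat \<Rightarrow> nat) \<Rightarrow> nat set" where
  "graph_verts q d = {i \<in> {1..q}. d i \<ge> 3}"

definition graph_adj :: "nat set \<Rightarrow> (nat \<Rightarrow> nat) \<Rightarrow> nat rel" where
  "graph_adj V d = {(i, j) \<in> V \<times> V. i \<noteq> j \<and> gcd (d i) (d j) \<ge> 3}"

text \<open>A graph is given by its vertex set \<open>V\<close> and its (symmetric) adjacency relation \<open>E\<close>.\<close>

definition graph_components :: "'a set \<Rightarrow> 'a rel \<Rightarrow> 'a set set" where
  "graph_components V E = V // {(u, v) \<in> V \<times> V. (u, v) \<in> E\<^sup>*}"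

text \<open>Truncated subtraction yields the convention that the empty graph has value \<open>0\<close>.\<close>

definition reduced_betti0 :: "'a set \<Rightarrow> 'a rel \<Rightarrow> nat" where
  "reduced_betti0 V E = card (graph_components V E) - 1"

subsection \<open>Well-definedness of the action\<close>

lemma pm_rep_unique:
  assumes d: "d > 0" and r: "r \<in> J_set d" "s \<in> J_set d"
    and c: "[int r = int s] (mod int d) \<or> [int r = - int s] (mod int d)"
  shows "r = s"
proof (cases "d \<le> 2")
  case True
  then show ?thesis using r by (auto simp: J_set_def)
next
  case False
  then have b: "2 * r < d" "2 * s < d" and cop: "coprime r d"
    using r by (auto simp: J_set_def)
  have "r \<noteq> 0" using cop False by (intro notI) simp
  from c show ?thesis
  proof
    assume "[int r = int s] (mod int d)"
    then have "[r = s] (mod d)" by (simp add: cong_int_iff)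
    then show ?thesis using b by (simp add: cong_less_modulus_unique_nat)
  next
    assume "[int r = - int s] (mod int d)"
    then have "int d dvd int r + int s" by (simp add: cong_iff_dvd_diff)
    then have "d dvd r + s" by (metis int_dvd_int_iff of_nat_add)
    then have "d \<le> r + s" using \<open>r \<noteq> 0\<close> by (intro dvd_imp_le) auto
    then show ?thesis using b by simp
  qed
qed

lemma pm_rep_ex:
  assumes d: "d > 0" and k: "coprime k (int d)"
  shows "\<exists>r\<in>J_set d. [k = int r] (mod int d) \<or> [k = - int r] (mod int d)"
proof (cases "d \<le> 2")
  case True
  with d consider "d = 1" | "d = 2" by linarith
  then show ?thesis
  proof cases
    case 1
    then show ?thesis by (auto simp: J_set_def)
  next
    case 2
    then show ?thesis using k by (auto simp: J_set_def cong_def odd_iff_mod_2_eq_one)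
  qed
next
  case False
  define m where "m = nat (k mod int d)"
  have m: "int m = k mod int d" "m < d"
    using d by (simp_all add: m_def nat_less_iff)
  have cm: "[k = int m] (mod int d)" using m by (simp add: cong_def)
  have cop: "coprime m d"
    using k m by (metis coprime_int_iff coprime_mod_left_iff d of_nat_0_eq_iff less_not_refl)
  show ?thesis
  proof (cases "2 * m < d")
    case True
    then show ?thesis using False cm cop by (auto simp: J_set_def)
  next
    case ge: False
    have "2 * m \<noteq> d"
    proof
      assume e: "2 * m = d"
      then have "m dvd d" by auto
      then have "m = 1" using cop by (simp add: coprime_absorb_left)
      then show False using e False by simp
    qed
    then have lt: "2 * (d - m) < d" using ge m by linarith
    have "coprime (d - m) d"
    proof (rule coprimeI)
      fix c assume c: "c dvd d - m" "c dvd d"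
      then have "c dvd m" using m by (metis dvd_diffD1 less_imp_le)
      with c show "is_unit c" using cop by (auto dest: coprime_common_divisor)
    qed
    moreover have "[k = - int (d - m)] (mod int d)"
    proof -
      have "- int (d - m) = int m - int d" using m by (simp add: of_nat_diff)
      then show ?thesis using cm by (simp add: cong_def)
    qed
    ultimately show ?thesis using False lt by (auto simp: J_set_def)
  qed
qed

lemma pm_rep_eqI:
  assumes d: "d > 0" and r: "r \<in> J_set d"
    and c: "[k = int r] (mod int d) \<or> [k = - int r] (mod int d)"
  shows "pm_rep d k = r"
  unfolding pm_rep_def
proof (rule the_equality)
  fix s assume s: "s \<in> J_set d \<and> ([k = int s] (mod int d) \<or> [k = - int s] (mod int d))"
  have "[int s = int r] (mod int d) \<or> [int s = - int r] (mod int d)"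
    using s c by (metis cong_minus_minus_iff cong_sym cong_trans minus_minus)
  then show "s = r" using pm_rep_unique[OF d] s r by blast
qed (use r c in auto)

lemma pm_rep_props:
  assumes "d > 0" "coprime k (int d)"
  shows "pm_rep d k \<in> J_set d"
    and "[k = int (pm_rep d k)] (mod int d) \<or> [k = - int (pm_rep d k)] (mod int d)"
proof -
  obtain r where r: "r \<in> J_set d" "[k = int r] (mod int d) \<or> [k = - int r] (mod int d)"
    using pm_rep_ex[OF assms] by blast
  have e: "pm_rep d k = r" by (rule pm_rep_eqI[OF assms(1) r])
  show "pm_rep d k \<in> J_set d"
    and "[k = int (pm_rep d k)] (mod int d) \<or> [k = - int (pm_rep d k)] (mod int d)"
    unfolding e by (rule r)+
qed

lemma pm_rep_cong:
  assumes "[k = l] (mod int d)"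
  shows "pm_rep d k = pm_rep d l"
proof -
  have "[k = x] (mod int d) \<longleftrightarrow> [l = x] (mod int d)" for x
    using assms by (auto simp: cong_def)
  then show ?thesis by (simp add: pm_rep_def)
qed

lemma J_set_coprime: "d > 0 \<Longrightarrow> j \<in> J_set d \<Longrightarrow> coprime (int j) (int d)"
  by (auto simp: J_set_def split: if_splits)

lemma ZFact_class:
  "Idl\<^bsub>\<Z>\<^esub> {int N} +>\<^bsub>\<Z>\<^esub> a = {x. [x = a] (mod int N)}"
proof -
  have "Idl\<^bsub>\<Z>\<^esub> {int N} +>\<^bsub>\<Z>\<^esub> a = {y + a |y. int N dvd y}"
    by (auto simp: a_r_coset_def r_coset_def int_Idl dvd_def mult.commute)
  also have "\<dots> = {x. [x = a] (mod int N)}"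
    by (force simp: cong_iff_dvd_diff intro: exI[of _ "_ - a"])
  finally show ?thesis .
qed

lemma carrier_ZFact: "carrier (ZFact (int N)) = {{x. [x = a] (mod int N)} |a. True}"
proof -
  have "carrier (ZFact (int N)) = {Idl\<^bsub>\<Z>\<^esub> {int N} +>\<^bsub>\<Z>\<^esub> a |a. True}"
    by (auto simp: ZFact_def FactRing_def A_RCOSETS_def')
  then show ?thesis by (simp only: ZFact_class)
qed

lemma mult_ZFact:
  "{x. [x = a] (mod int N)} \<otimes>\<^bsub>ZFact (int N)\<^esub> {x. [x = b] (mod int N)} =
    {x. [x = a * b] (mod int N)}"
proof -
  have I: "ideal (Idl\<^bsub>\<Z>\<^esub> {int N}) \<Z>" by (simp add: int.genideal_ideal)
  have "rcoset_mult \<Z> (Idl\<^bsub>\<Z>\<^esub> {int N}) (Idl\<^bsub>\<Z>\<^esub> {int N} +>\<^bsub>\<Z>\<^esub> a) (Idl\<^bsub>\<Z>\<^esub> {int N} +>\<^bsub>\<Z>\<^esub> b)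
    = Idl\<^bsub>\<Z>\<^esub> {int N} +>\<^bsub>\<Z>\<^esub> (a \<otimes>\<^bsub>\<Z>\<^esub> b)"
    by (rule ideal.rcoset_mult_add[OF I]) auto
  then show ?thesis by (simp add: ZFact_class ZFact_def FactRing_def)
qed

lemma one_ZFact: "\<one>\<^bsub>ZFact (int N)\<^esub> = {x. [x = 1] (mod int N)}"
  by (simp add: ZFact_def FactRing_def ZFact_class)

lemma class_eq_iff: "{x. [x = a] (mod int N)} = {x. [x = b] (mod int N)} \<longleftrightarrow> [a = b] (mod int N)"
  by (auto simp: set_eq_iff intro: cong_sym cong_trans)

lemma mod_units_carrier:
  "carrier (mod_units N) = {{x. [x = a] (mod int N)} |a. coprime a (int N)}"
proof -
  have "A \<in> Units (ZFact (int N)) \<longleftrightarrow>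
    (\<exists>a. A = {x. [x = a] (mod int N)} \<and> coprime a (int N))" (is "_ \<longleftrightarrow> ?R") for A
  proof
    assume "A \<in> Units (ZFact (int N))"
    then obtain B where "A \<in> carrier (ZFact (int N))" "B \<in> carrier (ZFact (int N))"
      and AB: "A \<otimes>\<^bsub>ZFact (int N)\<^esub> B = \<one>\<^bsub>ZFact (int N)\<^esub>"
      unfolding Units_def by blast
    then obtain a b where a: "A = {x. [x = a] (mod int N)}" and b: "B = {x. [x = b] (mod int N)}"
      unfolding carrier_ZFact by blast
    have "[a * b = 1] (mod int N)"
      using AB unfolding a b mult_ZFact one_ZFact class_eq_iff .
    then show ?R using a coprime_iff_invertible_int by blast
  next
    assume ?R
    then obtain a b where a: "A = {x. [x = a] (mod int N)}" and b: "[a * b = 1] (mod int N)"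
      using coprime_iff_invertible_int by blast
    let ?B = "{x. [x = b] (mod int N)}"
    have "A \<otimes>\<^bsub>ZFact (int N)\<^esub> ?B = \<one>\<^bsub>ZFact (int N)\<^esub>"
      using b unfolding a mult_ZFact one_ZFact class_eq_iff .
    moreover have "?B \<otimes>\<^bsub>ZFact (int N)\<^esub> A = \<one>\<^bsub>ZFact (int N)\<^esub>"
      using b unfolding a mult_ZFact one_ZFact class_eq_iff by (simp add: mult.commute)
    moreover have "A \<in> carrier (ZFact (int N))" "?B \<in> carrier (ZFact (int N))"
      unfolding a carrier_ZFact by blast+
    ultimately show "A \<in> Units (ZFact (int N))" unfolding Units_def by blast
  qed
  then show ?thesis by (auto simp: mod_units_def units_of_def)
qed

lemma unit_act_apply:
  assumes A: "A \<in> carrier (mod_units (\<Prod>i=1..q. d i))" and a: "a \<in> A"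
    and j: "j \<in> J_tuples q d" and i: "i \<in> {1..q}"
  shows "unit_act q d A j i = pm_rep (d i) (a * int (j i))"
proof -
  let ?b = "SOME a. a \<in> A"
  have b: "?b \<in> A" using a by (rule someI)
  have "[?b = a] (mod int (\<Prod>i=1..q. d i))"
    using A a b unfolding mod_units_carrier by (auto intro: cong_sym cong_trans)
  moreover have "int (d i) dvd int (\<Prod>i=1..q. d i)"
    using i by (subst int_dvd_int_iff) (rule dvd_prodI, auto)
  ultimately have "[?b = a] (mod int (d i))" by (rule cong_dvd_modulus)
  then have "[?b * int (j i) = a * int (j i)] (mod int (d i))" by (rule cong_scalar_right)
  then show ?thesis using i j by (simp add: unit_act_def pm_rep_cong)
qed

lemma group_mod_units: "group (mod_units N)"
  using ZFact_is_cring[of "int N"]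
  by (simp add: mod_units_def monoid.units_group cring_def ring.is_monoid)

lemma coprime_prodD:
  fixes q :: nat
  assumes "coprime (a::int) (int (\<Prod>i=1..q. d i))" "i \<in> {1..q}"
  shows "coprime a (int (d i))"
proof -
  have "d i dvd (\<Prod>i=1..q. d i)" using assms(2) by (intro dvd_prodI) auto
  then show ?thesis using assms(1) by (metis coprime_divisors dvd_refl int_dvd_int_iff)
qed

theorem unit_act_group_action:
  assumes pos: "\<And>i. i \<in> {1..q} \<Longrightarrow> d i \<ge> 1"
  shows "group_action (mod_units (\<Prod>i=1..q. d i)) (J_tuples q d) (unit_act q d)"
proof -
  let ?N = "\<Prod>i=1..q. d i"
  let ?G = "mod_units ?N"
  let ?C = "\<lambda>a. {x. [x = a] (mod int ?N)}"
  interpret G: group ?G by (rule group_mod_units)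
  have cls: "?C a \<in> carrier ?G" if "coprime a (int ?N)" for a
    using that by (auto simp: mod_units_carrier)
  have app: "unit_act q d (?C a) j i = pm_rep (d i) (a * int (j i))"
    if "coprime a (int ?N)" "j \<in> J_tuples q d" "i \<in> {1..q}" for a j i
    by (rule unit_act_apply) (use that cls in auto)
  have inJ: "j i \<in> J_set (d i)" if "j \<in> J_tuples q d" "i \<in> {1..q}" for j i
    using that by (auto simp: J_tuples_def)
  have cop: "coprime (a * int (j i)) (int (d i))"
    if "coprime a (int ?N)" "j \<in> J_tuples q d" "i \<in> {1..q}" for a j i
    using coprime_prodD[OF that(1,3)] J_set_coprime[OF _ inJ[OF that(2,3)]] pos[OF that(3)]
    by simp
  have mem: "unit_act q d (?C a) j \<in> J_tuples q d"
    if "coprime a (int ?N)" "j \<in> J_tuples q d" for a j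
  proof -
    note that' = that
    have "unit_act q d (?C a) j \<in> extensional {1..q}"
      using that(2) by (simp add: unit_act_def)
    moreover have "unit_act q d (?C a) j i \<in> J_set (d i)" if i: "i \<in> {1..q}" for i
      using app[OF that' i] pm_rep_props(1)[OF _ cop[OF that' i]] pos[OF i] by simp
    ultimately show ?thesis by (auto simp: J_tuples_def PiE_def)
  qed
  have ext: "f = g" if "f \<in> J_tuples q d" "g \<in> J_tuples q d" "\<And>i. i \<in> {1..q} \<Longrightarrow> f i = g i"
    for f g
    using that unfolding J_tuples_def by (rule PiE_ext)
  have comp: "unit_act q d (?C (a * b)) j = unit_act q d (?C a) (unit_act q d (?C b) j)"
    if a: "coprime a (int ?N)" and b: "coprime b (int ?N)" and j: "j \<in> J_tuples q d" for a b j
  proof (rule ext)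
    have ab: "coprime (a * b) (int ?N)" using a b by simp
    show "unit_act q d (?C (a * b)) j \<in> J_tuples q d" by (rule mem[OF ab j])
    show "unit_act q d (?C a) (unit_act q d (?C b) j) \<in> J_tuples q d"
      by (rule mem[OF a mem[OF b j]])
    fix i assume i: "i \<in> {1..q}"
    have d: "d i > 0" using pos[OF i] by simp
    define r where "r = pm_rep (d i) (b * int (j i))"
    define s where "s = pm_rep (d i) (a * int r)"
    have r: "unit_act q d (?C b) j i = r" using app[OF b j i] by (simp add: r_def)
    have s: "unit_act q d (?C a) (unit_act q d (?C b) j) i = s"
      using app[OF a mem[OF b j] i] r by (simp add: s_def)
    have "coprime (a * int r) (int (d i))" using cop[OF a mem[OF b j] i] r by simp
    from pm_rep_props[OF d this, folded s_def]
    have sJ: "s \<in> J_set (d i)"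
      and sc: "[a * int r = int s] (mod int (d i)) \<or> [a * int r = - int s] (mod int (d i))" .
    have rc: "[b * int (j i) = int r] (mod int (d i)) \<or> [b * int (j i) = - int r] (mod int (d i))"
      using pm_rep_props(2)[OF d cop[OF b j i]] by (simp add: r_def)
    have "[a * b * int (j i) = a * int r] (mod int (d i)) \<or>
      [a * b * int (j i) = - (a * int r)] (mod int (d i))"
      using rc cong_scalar_left[of "b * int (j i)" "int r" "int (d i)" a]
        cong_scalar_left[of "b * int (j i)" "- int r" "int (d i)" a]
      by (auto simp: mult.assoc)
    then have "[a * b * int (j i) = int s] (mod int (d i)) \<or>
      [a * b * int (j i) = - int s] (mod int (d i))"
      using sc cong_minus_minus_iff[of "a * int r" _ "int (d i)"]
      by (metis cong_trans minus_minus)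
    then have "pm_rep (d i) (a * b * int (j i)) = s" by (rule pm_rep_eqI[OF d sJ])
    then show "unit_act q d (?C (a * b)) j i = unit_act q d (?C a) (unit_act q d (?C b) j) i"
      using app[OF ab j i] s by simp
  qed
  have one: "unit_act q d (?C 1) j = j" if j: "j \<in> J_tuples q d" for j
  proof (rule ext[OF mem[OF _ j] j])
    fix i assume i: "i \<in> {1..q}"
    then show "unit_act q d (?C 1) j i = j i"
      using app[OF _ j i, of 1] pm_rep_eqI[OF _ inJ[OF j i]] pos[OF i] by simp
  qed simp
  have bij: "unit_act q d (?C a) \<in> Bij (J_tuples q d)" if a: "coprime a (int ?N)" for a
  proof -
    obtain b where ab: "[a * b = 1] (mod int ?N)" using a coprime_iff_invertible_int by blast
    then have b: "coprime b (int ?N)"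
      using coprime_iff_invertible_int by (metis mult.commute)
    have e: "?C (a * b) = ?C 1" "?C (b * a) = ?C 1"
      using ab by (simp_all only: class_eq_iff mult.commute[of b a])
    have "bij_betw (unit_act q d (?C a)) (J_tuples q d) (J_tuples q d)"
    proof (rule bij_betwI[where g = "unit_act q d (?C b)"])
      fix j assume j: "j \<in> J_tuples q d"
      show "unit_act q d (?C b) (unit_act q d (?C a) j) = j"
        using comp[OF b a j] one[OF j] e by simp
      show "unit_act q d (?C a) (unit_act q d (?C b) j) = j"
        using comp[OF a b j] one[OF j] e by simp
    qed (use mem a b in auto)
    then show ?thesis by (simp add: Bij_def unit_act_def)
  qed
  have "unit_act q d \<in> hom ?G (BijGroup (J_tuples q d))"
  proof (rule homI)
    fix A assume "A \<in> carrier ?G"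
    then show "unit_act q d A \<in> carrier (BijGroup (J_tuples q d))"
      using bij by (auto simp: mod_units_carrier BijGroup_def)
  next
    fix A B assume "A \<in> carrier ?G" "B \<in> carrier ?G"
    then obtain a b where A: "A = ?C a" "coprime a (int ?N)" and B: "B = ?C b" "coprime b (int ?N)"
      unfolding mod_units_carrier by blast
    have AB: "A \<otimes>\<^bsub>?G\<^esub> B = ?C (a * b)"
      unfolding A B mod_units_def units_of_def using mult_ZFact[where N = ?N and a = a and b = b] by simp
    have "unit_act q d (?C (a * b)) = compose (J_tuples q d) (unit_act q d A) (unit_act q d B)"
    proof (rule extensionalityI)
      show "unit_act q d (?C (a * b)) \<in> extensional (J_tuples q d)" by (simp add: unit_act_def)
      fix j assume "j \<in> J_tuples q d"
      then show "unit_act q d (?C (a * b)) j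
        = compose (J_tuples q d) (unit_act q d A) (unit_act q d B) j"
        using comp[OF A(2) B(2)] by (simp add: compose_eq A(1) B(1))
    qed simp
    then show "unit_act q d (A \<otimes>\<^bsub>?G\<^esub> B)
      = unit_act q d A \<otimes>\<^bsub>BijGroup (J_tuples q d)\<^esub> unit_act q d B"
      unfolding AB using bij[OF A(2)] bij[OF B(2)] by (simp add: BijGroup_def A(1) B(1))
  qed
  then show ?thesis
    by (simp add: group_action_def group_hom_def group_hom_axioms_def group_BijGroup
        group_mod_units)
qed

end

theory Submission
  imports Defs
begin

text \<open>
  Put \<open>L = lcm(d\<^sub>1, \<dots>, d\<^sub>q)\<close>.  Since \<open>N\<close> and \<open>L\<close> have the same prime divisors, the units modulo \<open>L\<close>
  sweep out every orbit.  Two units \<open>a, b\<close> send a tuple to the same tuple iff \<open>a \<equiv> \<plusminus>b (mod d\<^sub>i)\<close>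
  for all \<open>i\<close>.  The sign is uniquely determined exactly for \<open>d\<^sub>i \<ge> 3\<close>, and by the Chinese remainder
  theorem for non-coprime moduli a choice of signs is realised iff it is constant on edges of the
  graph: \<open>b \<equiv> -b\<close> modulo \<open>gcd(d\<^sub>i, d\<^sub>j)\<close> holds iff that gcd is at most \<open>2\<close>.  So all orbits have
  \<open>\<phi>(L) / 2\<^sup>c\<close> elements, where \<open>c\<close> is the number of components; dividing gives the count.
\<close>

section \<open>Number of tuples\<close>

text \<open>The reflection \<open>j \<mapsto> d - j\<close> exchanges the totatives below
  \<open>d / 2\<close> with those above. None is fixed: \<open>2 * j = d\<close> with
  \<open>j\<close> coprime to \<open>d\<close> forces \<open>j = 1\<close> and
  \<open>d = 2\<close>.\<close>

lemma card_J_set: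
  assumes "d > 0"
  shows "real (card (J_set d)) = totient_tilde d"
proof (cases "d \<le> 2")
  case True
  then show ?thesis by (simp add: J_set_def totient_tilde_def)
next
  case False
  then have J: "J_set d = {j. 2 * j < d \<and> coprime j d}" by (simp add: J_set_def)
  have fin: "finite (J_set d)" unfolding J by (rule finite_subset[of _ "{..d}"]) auto
  have nz: "j \<noteq> 0" if "coprime j d" for j using that False by (intro notI) simp
  have reflect: "coprime (d - j) d" if "coprime j d" "j \<le> d" for j
    using that by (metis coprime_iff_gcd_eq_1 gcd.commute gcd_diff2_nat)
  have half: "2 * j \<noteq> d" if "coprime j d" for j
  proof
    assume e: "2 * j = d"
    then have "j dvd d" by auto
    then have "j = 1" using that by (simp add: coprime_absorb_left)
    then show False using e False by simp
  qed
  have "bij_betw (\<lambda>j. d - j) (J_set d) (totatives d - J_set d)"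
  proof (rule bij_betwI[where g = "\<lambda>j. d - j"])
    show "(\<lambda>j. d - j) \<in> J_set d \<rightarrow> totatives d - J_set d"
      using reflect unfolding J totatives_def by auto
    show "(\<lambda>j. d - j) \<in> totatives d - J_set d \<rightarrow> J_set d"
    proof
      fix j assume "j \<in> totatives d - J_set d"
      then have j: "coprime j d" "j \<le> d" "\<not> 2 * j < d" by (auto simp: J totatives_def)
      then have "2 * (d - j) < d" using half[OF j(1)] by linarith
      then show "d - j \<in> J_set d" using reflect[OF j(1,2)] by (simp add: J)
    qed
  qed (auto simp: J totatives_def)
  then have "card (totatives d - J_set d) = card (J_set d)" by (simp add: bij_betw_same_card)
  moreover have sub: "J_set d \<subseteq> totatives d" using nz by (auto simp: J totatives_def)
  ultimately have "totient d = 2 * card (J_set d)"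
    using card_mono[OF finite_totatives sub] by (simp add: totient_def card_Diff_subset[OF fin sub])
  then show ?thesis using False by (simp add: totient_tilde_def)
qed

lemma card_J_tuples:
  assumes "\<And>i. i \<in> {1..q} \<Longrightarrow> d i \<ge> 1"
  shows "real (card (J_tuples q d)) = (\<Prod>i=1..q. totient_tilde (d i))"
  unfolding J_tuples_def card_PiE[OF finite_atLeastAtMost] of_nat_prod
  by (rule prod.cong[OF refl], rule card_J_set) (use assms in force)

lemma finite_J_set: "finite (J_set d)"
  by (rule finite_subset[of _ "{..d} \<union> {1}"]) (auto simp: J_set_def)

lemma finite_J_tuples: "finite (J_tuples q d)"
  unfolding J_tuples_def by (intro finite_PiE finite_J_set) simp

section \<open>Equality of representatives up to sign\<close>

lemma pm_rep_eq_iff: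
  assumes d: "d > 0" and k: "coprime k (int d)" and l: "coprime l (int d)"
  shows "pm_rep d k = pm_rep d l \<longleftrightarrow> [k = l] (mod int d) \<or> [k = - l] (mod int d)"
proof
  assume "pm_rep d k = pm_rep d l"
  then show "[k = l] (mod int d) \<or> [k = - l] (mod int d)"
    using pm_rep_props(2)[OF d k] pm_rep_props(2)[OF d l]
    by (metis cong_minus_minus_iff cong_sym cong_trans minus_minus)
next
  assume "[k = l] (mod int d) \<or> [k = - l] (mod int d)"
  then have "[k = int (pm_rep d l)] (mod int d) \<or> [k = - int (pm_rep d l)] (mod int d)"
    using pm_rep_props(2)[OF d l]
    by (metis cong_minus_minus_iff cong_trans minus_minus)
  then show "pm_rep d k = pm_rep d l"
    by (rule pm_rep_eqI[OF d pm_rep_props(1)[OF d l]])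
qed

text \<open>The unit \<open>j\<close> cancels from both congruences. The criterion no longer
  mentions \<open>j\<close>, which is why all orbits turn out to have the same size.\<close>

lemma pm_rep_mult_eq_iff:
  assumes d: "d > 0" and a: "coprime a (int d)" and b: "coprime b (int d)"
    and j: "coprime j (int d)"
  shows "pm_rep d (a * j) = pm_rep d (b * j) \<longleftrightarrow> [a = b] (mod int d) \<or> [a = - b] (mod int d)"
  using pm_rep_eq_iff[OF d, of "a * j" "b * j"] a b j
    cong_mult_rcancel[OF j, of a b] cong_mult_rcancel[OF j, of a "- b"]
  by simp

section \<open>Chinese remainder theorem for arbitrary moduli\<close>

text \<open>Since gcd distributes over lcm, the left side is the lcm of the numbers
  \<open>gcd (m i) n\<close>. This reduces solvability against a combined modulus to pairwise
  conditions.\<close>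

lemma gcd_Lcm_dvd:
  fixes m :: "'a \<Rightarrow> int"
  assumes "finite I" and "\<And>i. i \<in> I \<Longrightarrow> gcd (m i) n dvd x"
  shows "gcd (Lcm (m ` I)) n dvd x"
  using assms
proof (induction I rule: finite_induct)
  case (insert i I)
  have "gcd (lcm (m i) (Lcm (m ` I))) n = lcm (gcd (m i) n) (gcd (Lcm (m ` I)) n)"
    using gcd_lcm_distrib[of n "m i" "Lcm (m ` I)"] by (simp add: gcd.commute)
  then show ?case using insert by (simp add: lcm_least)
qed simp

text \<open>Induction on the index set: a solution \<open>x\<close> for the old moduli may be
  shifted by any multiple of their lcm, and pairwise compatibility together with
  \<open>gcd_Lcm_dvd\<close> provides a multiple that also meets the new congruence.\<close>

lemma chinese_remainder_gcd:
  fixes m a :: "'a \<Rightarrow> int"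
  assumes "finite I"
    and "\<And>i j. i \<in> I \<Longrightarrow> j \<in> I \<Longrightarrow> [a i = a j] (mod gcd (m i) (m j))"
  shows "\<exists>x. \<forall>i\<in>I. [x = a i] (mod m i)"
  using assms
proof (induction I rule: finite_induct)
  case (insert k I)
  then obtain x where x: "\<And>i. i \<in> I \<Longrightarrow> [x = a i] (mod m i)" by blast
  have "gcd (Lcm (m ` I)) (m k) dvd a k - x"
  proof (rule gcd_Lcm_dvd[OF insert.hyps(1)])
    fix i assume i: "i \<in> I"
    have "[a k = a i] (mod gcd (m i) (m k))"
      using insert.prems[of i k] i by (auto intro: cong_sym)
    moreover have "[a i = x] (mod gcd (m i) (m k))"
      using x[OF i] by (meson cong_dvd_modulus cong_sym gcd_dvd1)
    ultimately show "gcd (m i) (m k) dvd a k - x"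
      unfolding cong_iff_dvd_diff[symmetric] by (rule cong_trans)
  qed
  then obtain t where t: "[Lcm (m ` I) * t = a k - x] (mod m k)"
    using cong_solve_dvd_int by blast
  let ?y = "x + Lcm (m ` I) * t"
  have "[?y = a k] (mod m k)" using cong_add[OF cong_refl[of x] t] by simp
  moreover have "[?y = a i] (mod m i)" if i: "i \<in> I" for i
  proof -
    have "m i dvd Lcm (m ` I) * t" using i by (simp add: dvd_Lcm)
    then have "[?y = x] (mod m i)" by (simp add: cong_iff_dvd_diff)
    then show ?thesis using x[OF i] by (rule cong_trans)
  qed
  ultimately show ?case by blast
qed simp

section \<open>Edge-closed vertex sets and connected components\<close>

text \<open>By symmetry of \<open>E\<close>, reachability is an equivalence relation whose classes
  are the components. A set closed under \<open>E\<close> is a union of components, so such sets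
  correspond to arbitrary sets of components.\<close>

lemma card_closed_subsets:
  assumes fin: "finite V" and E: "E \<subseteq> V \<times> V" "sym E"
  shows "card {U. U \<subseteq> V \<and> E `` U \<subseteq> U} = 2 ^ card (graph_components V E)"
proof -
  define R where "R = {(u, v) \<in> V \<times> V. (u, v) \<in> E\<^sup>*}"
  have eq: "equiv V R"
  proof (rule equivI)
    show "sym R" using sym_rtrancl[OF E(2)] by (auto simp: R_def sym_def)
  qed (auto simp: R_def refl_on_def trans_def)
  have RE: "(u, v) \<in> R" if "(u, v) \<in> E" for u v using that E(1) by (auto simp: R_def)
  have closed: "v \<in> U" if U: "E `` U \<subseteq> U" "u \<in> U" and uv: "(u, v) \<in> R" for U u v
  proof -
    have "(u, v) \<in> E\<^sup>*" using uv by (simp add: R_def)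
    then show ?thesis using U by induction auto
  qed
  have "bij_betw \<Union> (Pow (V // R)) {U. U \<subseteq> V \<and> E `` U \<subseteq> U}"
  proof (rule bij_betwI[where g = "\<lambda>U. {C \<in> V // R. C \<subseteq> U}"])
    show "\<Union> \<in> Pow (V // R) \<rightarrow> {U. U \<subseteq> V \<and> E `` U \<subseteq> U}"
    proof
      fix T assume T: "T \<in> Pow (V // R)"
      have "\<Union> T \<subseteq> V" using T Union_quotient[OF eq] by blast
      moreover have "E `` \<Union> T \<subseteq> \<Union> T"
        using T in_quotient_imp_closed[OF eq] RE by blast
      ultimately show "\<Union> T \<in> {U. U \<subseteq> V \<and> E `` U \<subseteq> U}" by simp
    qed
    show "{C \<in> V // R. C \<subseteq> \<Union> T} = T" if T: "T \<in> Pow (V // R)" for T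
    proof
      show "{C \<in> V // R. C \<subseteq> \<Union> T} \<subseteq> T"
      proof
        fix C assume C: "C \<in> {C \<in> V // R. C \<subseteq> \<Union> T}"
        then obtain x where "x \<in> C" using in_quotient_imp_non_empty[OF eq] by blast
        moreover obtain D where "D \<in> T" "x \<in> D" using C \<open>x \<in> C\<close> by blast
        ultimately have "C = D" using quotient_disj[OF eq, of C D] C T by blast
        then show "C \<in> T" using \<open>D \<in> T\<close> by simp
      qed
    qed (use T in blast)
    show "\<Union> {C \<in> V // R. C \<subseteq> U} = U" if "U \<in> {U. U \<subseteq> V \<and> E `` U \<subseteq> U}" for U
    proof
      show "U \<subseteq> \<Union> {C \<in> V // R. C \<subseteq> U}"
      proof
        fix u assume u: "u \<in> U"
        then have uV: "u \<in> V" using that by blast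
        have "R `` {u} \<subseteq> U" using closed[OF _ u] that by blast
        then show "u \<in> \<Union> {C \<in> V // R. C \<subseteq> U}"
          using quotientI[OF uV, of R] equiv_class_self[OF eq uV] by blast
      qed
    qed blast
  qed auto
  then have "card {U. U \<subseteq> V \<and> E `` U \<subseteq> U} = card (Pow (V // R))"
    by (simp add: bij_betw_same_card)
  also have "\<dots> = 2 ^ card (V // R)"
    by (rule card_Pow, rule finite_quotient[OF fin]) (auto simp: R_def)
  finally show ?thesis by (simp add: graph_components_def R_def)
qed

section \<open>Signs modulo small numbers; totatives as representatives\<close>

text \<open>The unit \<open>b\<close> cancels from \<open>g dvd 2 * b\<close>. Applied with
  \<open>g = d i\<close> it makes the sign at a vertex unique; applied with a gcd it forces equal
  signs along an edge.\<close>

lemma cong_uminus_self_imp_le_2: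
  assumes "coprime b (int g)" "[b = - b] (mod int g)"
  shows "g \<le> 2"
proof -
  have "int g dvd 2 * b" using assms(2) by (simp add: cong_iff_dvd_diff)
  then have "int g dvd 2" using assms(1) by (simp add: coprime_commute coprime_dvd_mult_left_iff)
  then have "g dvd 2" by (metis int_dvd_int_iff of_nat_numeral)
  then show ?thesis by (simp add: dvd_imp_le)
qed

lemma cong_uminus_self_le_2:
  assumes "coprime b (int g)" "0 < g" "g \<le> 2"
  shows "[b = - b] (mod int g)"
proof -
  have "g = 1 \<or> g = 2" using assms by linarith
  then show ?thesis by (auto simp: cong_iff_dvd_diff)
qed

lemma totative_rep_ex:
  assumes "n > 0" "coprime x (int n)"
  shows "\<exists>t\<in>totatives n. [int t = x] (mod int n)"
proof -
  \<comment> \<open>Totatives lie in \<open>{1..n}\<close>, so residue \<open>0\<close> is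
    represented by \<open>n\<close>. For \<open>x\<close> coprime to \<open>n\<close> this happens
    only when \<open>n = 1\<close>.\<close>
  define t where "t = (if nat (x mod int n) = 0 then n else nat (x mod int n))"
  have c: "[int t = x] (mod int n)" using assms(1) by (auto simp: t_def cong_def)
  have "coprime (int t) (int n)" using assms(2) cong_imp_coprime[OF cong_sym[OF c]] by blast
  moreover have "0 < t" "t \<le> n" using assms(1) by (auto simp: t_def nat_le_iff intro: less_imp_le)
  ultimately show ?thesis using c by (auto simp: in_totatives_iff)
qed

lemma totative_rep_unique:
  assumes "s \<in> totatives n" "t \<in> totatives n" "[int s = int t] (mod int n)"
  shows "s = t"
proof -
  have "int n dvd int s - int t" using assms(3) by (simp add: cong_iff_dvd_diff)
  moreover have "\<bar>int s - int t\<bar> < int n" using assms(1,2) by (auto simp: in_totatives_iff)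
  ultimately have "int s - int t = 0" using dvd_imp_le_int[of "int s - int t" "int n"] by auto
  then show ?thesis by simp
qed

section \<open>Coprimality to the lcm and to the product\<close>

lemma Lcm_image_pos:
  fixes d :: "'a \<Rightarrow> nat"
  assumes "finite I" and "\<And>i. i \<in> I \<Longrightarrow> d i \<ge> 1"
  shows "Lcm (d ` I) > 0"
proof -
  have "0 \<notin> d ` I" using assms(2) by force
  then show ?thesis using assms(1) by (simp add: Lcm_0_iff flip: neq0_conv)
qed

lemma coprime_Lcm_iff:
  assumes "finite I"
  shows "coprime x (int (Lcm (d ` I))) \<longleftrightarrow> (\<forall>i\<in>I. coprime x (int (d i)))"
proof
  assume x: "coprime x (int (Lcm (d ` I)))"
  show "\<forall>i\<in>I. coprime x (int (d i))"
  proof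
    fix i assume "i \<in> I"
    then have "int (d i) dvd int (Lcm (d ` I))" by (simp add: dvd_Lcm)
    then show "coprime x (int (d i))" using x coprime_divisors[OF dvd_refl] by blast
  qed
next
  assume "\<forall>i\<in>I. coprime x (int (d i))"
  then have "coprime x (\<Prod>i\<in>I. int (d i))" by (intro prod_coprime_right) auto
  moreover have "int (Lcm (d ` I)) dvd (\<Prod>i\<in>I. int (d i))"
  proof -
    have "Lcm (d ` I) dvd (\<Prod>i\<in>I. d i)" using assms by (auto intro!: Lcm_least dvd_prodI)
    then show ?thesis by (metis int_dvd_int_iff of_nat_prod)
  qed
  ultimately show "coprime x (int (Lcm (d ` I)))" using coprime_divisors[OF dvd_refl] by blast
qed

text \<open>Both sides say that \<open>x\<close> is coprime to every \<open>d i\<close>. Hence the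
  units modulo the product can be replaced by units modulo the lcm when orbits are computed.\<close>

lemma coprime_prod_iff_coprime_Lcm:
  assumes "finite I"
  shows "coprime x (int (\<Prod>i\<in>I. d i)) \<longleftrightarrow> coprime x (int (Lcm (d ` I)))"
proof -
  have "coprime x (int (\<Prod>i\<in>I. d i)) \<longleftrightarrow> (\<forall>i\<in>I. coprime x (int (d i)))"
  proof
    assume x: "coprime x (int (\<Prod>i\<in>I. d i))"
    show "\<forall>i\<in>I. coprime x (int (d i))"
    proof
      fix i assume "i \<in> I"
      then have "int (d i) dvd int (\<Prod>i\<in>I. d i)"
        using assms by (subst int_dvd_int_iff) (rule dvd_prodI)
      then show "coprime x (int (d i))" using x coprime_divisors[OF dvd_refl] by blast
    qed
  qed (simp, intro prod_coprime_right, auto)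
  then show ?thesis using coprime_Lcm_iff[OF assms] by simp
qed

section \<open>Units congruent to a given unit up to signs\<close>

text \<open>Each such \<open>a\<close> is encoded by the set \<open>U a\<close> of vertices where it
  has the minus sign. This is a bijection onto the edge-closed vertex sets, which
  \<open>card_closed_subsets\<close> counts.\<close>

lemma card_cong_pm_totatives:
  fixes q :: nat and d :: "nat \<Rightarrow> nat" and b :: int
  defines "V \<equiv> graph_verts q d" and "L \<equiv> Lcm (d ` {1..q})"
  assumes pos: "\<And>i. i \<in> {1..q} \<Longrightarrow> d i \<ge> 1" and b: "coprime b (int L)"
  shows "card {a \<in> totatives L. \<forall>i\<in>{1..q}. [int a = b] (mod int (d i)) \<or> [int a = - b] (mod int (d i))}
    = 2 ^ card (graph_components V (graph_adj V d))"
proof -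
  define E where "E = graph_adj V d"
  define F where "F = {a \<in> totatives L. \<forall>i\<in>{1..q}. [int a = b] (mod int (d i)) \<or> [int a = - b] (mod int (d i))}"
  define U where "U = (\<lambda>a. {i \<in> V. [int a = - b] (mod int (d i))})"
  have L: "L > 0" unfolding L_def by (rule Lcm_image_pos) (use pos in auto)
  have dL: "int (d i) dvd int L" if "i \<in> {1..q}" for i
    using that by (simp add: L_def dvd_Lcm)
  have bd: "coprime b (int g)" if "i \<in> {1..q}" "g dvd d i" for g i
    using b dL[OF that(1)] that(2) by (meson coprime_divisors dvd_refl dvd_trans int_dvd_int_iff)
  have V: "i \<in> V \<longleftrightarrow> i \<in> {1..q} \<and> d i \<ge> 3" for i by (simp add: V_def graph_verts_def)
  have E: "(i, j) \<in> E \<longleftrightarrow> i \<in> V \<and> j \<in> V \<and> i \<noteq> j \<and> gcd (d i) (d j) \<ge> 3" for i j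
    by (simp add: E_def graph_adj_def)
  have not_both: False if "i \<in> V" "[x = b] (mod int (d i))" "[x = - b] (mod int (d i))" for i x
    using cong_uminus_self_imp_le_2[OF bd[OF _ dvd_refl], of i] that V
      cong_trans[OF cong_sym[OF that(2)] that(3)] by fastforce
  have sub: "U a \<in> {W. W \<subseteq> V \<and> E `` W \<subseteq> W}" if a: "a \<in> F" for a
  proof -
    \<comment> \<open>Opposite signs at the ends of an edge would give \<open>b \<equiv> -b\<close>
      modulo a gcd of at least 3.\<close>
    have "j \<in> U a" if i: "i \<in> U a" and ij: "(i, j) \<in> E" for i j
    proof (rule ccontr)
      assume j: "j \<notin> U a"
      have iV: "i \<in> {1..q}" and jV: "j \<in> V" "j \<in> {1..q}" and g: "gcd (d i) (d j) \<ge> 3"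
        using ij E V by auto
      have "[int a = b] (mod int (d j))" using a jV j by (auto simp: F_def U_def)
      then have "[b = int a] (mod int (gcd (d i) (d j)))"
        by (meson cong_dvd_modulus cong_sym gcd_dvd2 int_dvd_int_iff)
      moreover have "[int a = - b] (mod int (gcd (d i) (d j)))"
        using i by (auto simp: U_def intro: cong_dvd_modulus)
      ultimately have "[b = - b] (mod int (gcd (d i) (d j)))" by (rule cong_trans)
      with cong_uminus_self_imp_le_2[OF bd[OF iV gcd_dvd1]] g show False by fastforce
    qed
    moreover have "U a \<subseteq> V" by (simp add: U_def)
    ultimately show ?thesis by blast
  qed
  have inj: "a = a'" if a: "a \<in> F" "a' \<in> F" and eq: "U a = U a'" for a a'
  proof -
    \<comment> \<open>Equal sign patterns give equal residues modulo every \<open>d i\<close>; off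
      \<open>V\<close> both signs mean the same residue. The difference is taken as a natural number
      because \<open>L\<close> is an lcm of naturals.\<close>
    have "d i dvd nat \<bar>int a - int a'\<bar>" if i: "i \<in> {1..q}" for i
    proof -
      have pm: "[int a = b] (mod int (d i)) \<or> [int a = - b] (mod int (d i))"
        "[int a' = b] (mod int (d i)) \<or> [int a' = - b] (mod int (d i))"
        using a i by (auto simp: F_def)
      have "[int a = int a'] (mod int (d i))"
      proof (cases "i \<in> V")
        case True
        then have "[int a = - b] (mod int (d i)) \<longleftrightarrow> [int a' = - b] (mod int (d i))"
          using eq by (auto simp: U_def)
        then show ?thesis using pm by (auto simp: cong_def)
      next
        case False
        then have "[b = - b] (mod int (d i))"
          using cong_uminus_self_le_2[OF bd[OF i dvd_refl]] pos[OF i] i V by auto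
        then show ?thesis using pm by (auto simp: cong_def)
      qed
      then show ?thesis by (simp add: cong_iff_dvd_diff dvd_nat_abs_iff)
    qed
    then have "L dvd nat \<bar>int a - int a'\<bar>" unfolding L_def by (intro Lcm_least) auto
    then have "[int a = int a'] (mod int L)" by (simp add: cong_iff_dvd_diff dvd_nat_abs_iff)
    then show ?thesis using totative_rep_unique a by (auto simp: F_def)
  qed
  have surj: "\<exists>a\<in>F. U a = W" if W: "W \<subseteq> V" "E `` W \<subseteq> W" for W
  proof -
    \<comment> \<open>The residues prescribed by \<open>W\<close>. They are compatible because
      indices with different signs are not adjacent, so their gcd is at most 2 and \<open>b\<close>
      agrees with \<open>-b\<close> there.\<close>
    define s where "s = (\<lambda>i. if i \<in> W then - b else b)"
    have "[s i = s j] (mod gcd (int (d i)) (int (d j)))" if ij: "i \<in> {1..q}" "j \<in> {1..q}" for i j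
    proof (cases "i \<in> W \<longleftrightarrow> j \<in> W")
      case True
      then show ?thesis by (auto simp: s_def)
    next
      case False
      \<comment> \<open>These bounds show that a gcd of at least 3 makes both indices vertices,
        hence adjacent.\<close>
      have le: "gcd (d i) (d j) \<le> d i" "gcd (d i) (d j) \<le> d j"
        using pos[OF ij(1)] pos[OF ij(2)] by (auto intro: gcd_le1_nat gcd_le2_nat)
      have "\<not> gcd (d i) (d j) \<ge> 3"
      proof
        assume g: "gcd (d i) (d j) \<ge> 3"
        then have "(i, j) \<in> E" "(j, i) \<in> E" using False le ij by (auto simp: E V gcd.commute)
        then show False using W(2) False by blast
      qed
      moreover have "gcd (d i) (d j) > 0" using pos[OF ij(1)] by simp
      ultimately have "[b = - b] (mod int (gcd (d i) (d j)))"
        using cong_uminus_self_le_2[OF bd[OF ij(1) gcd_dvd1]] by simp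
      then show ?thesis using False by (auto simp: s_def intro: cong_sym)
    qed
    then have "\<exists>x. \<forall>i\<in>{1..q}. [x = s i] (mod int (d i))"
      by (rule chinese_remainder_gcd[OF finite_atLeastAtMost])
    then obtain x where x: "\<And>i. i \<in> {1..q} \<Longrightarrow> [x = s i] (mod int (d i))" by blast
    have "coprime x (int L)"
      unfolding L_def coprime_Lcm_iff[OF finite_atLeastAtMost]
    proof
      fix i assume i: "i \<in> {1..q}"
      have "coprime (s i) (int (d i))" using bd[OF i dvd_refl] by (simp add: s_def)
      then show "coprime x (int (d i))" using cong_imp_coprime[OF cong_sym[OF x[OF i]]] by blast
    qed
    then obtain t where t: "t \<in> totatives L" "[int t = x] (mod int L)"
      using totative_rep_ex[OF L] by blast
    have ts: "[int t = s i] (mod int (d i))" if i: "i \<in> {1..q}" for i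
      using cong_trans[OF cong_dvd_modulus[OF t(2) dL[OF i]] x[OF i]] .
    have "[int t = b] (mod int (d i)) \<or> [int t = - b] (mod int (d i))" if "i \<in> {1..q}" for i
      using ts[OF that] by (simp add: s_def split: if_splits)
    then have "t \<in> F" using t(1) by (simp add: F_def)
    moreover have "U t = W"
    proof (intro equalityI subsetI)
      fix i assume i: "i \<in> U t"
      then show "i \<in> W" using ts[of i] not_both[of i "int t"] V by (auto simp: U_def s_def split: if_splits)
    next
      fix i assume i: "i \<in> W"
      then show "i \<in> U t" using ts[of i] W(1) V by (auto simp: U_def s_def)
    qed
    ultimately show ?thesis by blast
  qed
  have "bij_betw U F {W. W \<subseteq> V \<and> E `` W \<subseteq> W}"
    unfolding bij_betw_def
  proof
    show "inj_on U F" using inj by (rule inj_onI)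
    show "U ` F = {W. W \<subseteq> V \<and> E `` W \<subseteq> W}" (is "_ = ?C")
    proof (intro equalityI subsetI)
      fix W assume "W \<in> ?C"
      then have "W \<subseteq> V" "E `` W \<subseteq> W" by simp_all
      from surj[OF this] show "W \<in> U ` F" by blast
    next
      fix W assume "W \<in> U ` F"
      then obtain a where "a \<in> F" "W = U a" by blast
      then show "W \<in> ?C" using sub by simp
    qed
  qed
  then have "card F = card {W. W \<subseteq> V \<and> E `` W \<subseteq> W}" by (rule bij_betw_same_card)
  also have "\<dots> = 2 ^ card (graph_components V E)"
  proof (rule card_closed_subsets)
    show "finite V" by (simp add: V_def graph_verts_def)
    show "E \<subseteq> V \<times> V" using E by auto
    show "sym E" using E by (auto simp: sym_def gcd.commute)
  qed
  finally show ?thesis by (simp add: F_def E_def)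
qed

section \<open>Size of an orbit\<close>

lemma restrict_eq_iff: "restrict f S = restrict g S \<longleftrightarrow> (\<forall>x\<in>S. f x = g x)"
  by (metis restrict_apply' restrict_ext)

text \<open>The totatives of \<open>L\<close> map onto the orbit of \<open>j\<close>, and by
  \<open>card_cong_pm_totatives\<close> every fibre has \<open>2 ^ c\<close> elements, where
  \<open>c\<close> is the number of components. The product form avoids division of
  naturals.\<close>

lemma card_orbit:
  fixes q :: nat and d :: "nat \<Rightarrow> nat"
  defines "V \<equiv> graph_verts q d" and "L \<equiv> Lcm (d ` {1..q})"
  assumes pos: "\<And>i. i \<in> {1..q} \<Longrightarrow> d i \<ge> 1" and j: "j \<in> J_tuples q d"
  shows "card (orbit (mod_units (\<Prod>i=1..q. d i)) (unit_act q d) j)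
      * 2 ^ card (graph_components V (graph_adj V d)) = totient L"
proof -
  let ?G = "mod_units (\<Prod>i=1..q. d i)"
  define f where "f = (\<lambda>a. \<lambda>i\<in>{1..q}. pm_rep (d i) (a * int (j i)))"
  define T where "T = totatives L"
  have L: "L > 0" unfolding L_def by (rule Lcm_image_pos) (use pos in auto)
  have jc: "coprime (int (j i)) (int (d i))" if "i \<in> {1..q}" for i
    using j pos[OF that] that by (intro J_set_coprime) (auto simp: J_tuples_def)
  have cop: "coprime a (int (d i))" if "coprime a (int L)" "i \<in> {1..q}" for a i
    using that coprime_Lcm_iff[of "{1..q}" a d] by (simp add: L_def)
  have act: "unit_act q d A j = f a" if "A \<in> carrier ?G" "a \<in> A" for A a
  proof
    fix i
    show "unit_act q d A j i = f a i"
    proof (cases "i \<in> {1..q}")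
      case True
      then show ?thesis using unit_act_apply[OF that j True] by (simp add: f_def)
    next
      case False
      then show ?thesis using j by (auto simp: unit_act_def f_def)
    qed
  qed
  \<comment> \<open>The classes remain classes modulo the product; only the coprimality condition is
    moved to \<open>L\<close>.\<close>
  have carrier: "carrier ?G = {{x. [x = a] (mod int (\<Prod>i=1..q. d i))} |a. coprime a (int L)}"
    unfolding mod_units_carrier L_def coprime_prod_iff_coprime_Lcm[OF finite_atLeastAtMost] ..
  have "orbit ?G (unit_act q d) j = f ` {a. coprime a (int L)}"
  proof (intro equalityI subsetI)
    fix y assume "y \<in> orbit ?G (unit_act q d) j"
    then obtain A where A: "A \<in> carrier ?G" "y = unit_act q d A j" by (auto simp: orbit_def)
    then obtain a where a: "A = {x. [x = a] (mod int (\<Prod>i=1..q. d i))}" "coprime a (int L)"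
      unfolding carrier by blast
    have "a \<in> A" using a(1) by simp
    then show "y \<in> f ` {a. coprime a (int L)}" using act[OF A(1)] A(2) a(2) by simp
  next
    fix y assume "y \<in> f ` {a. coprime a (int L)}"
    then obtain a where a: "coprime a (int L)" "y = f a" by blast
    let ?A = "{x. [x = a] (mod int (\<Prod>i=1..q. d i))}"
    have A: "?A \<in> carrier ?G" using a(1) unfolding carrier by blast
    have "y = unit_act q d ?A j" using act[OF A, of a] a(2) by simp
    then show "y \<in> orbit ?G (unit_act q d) j" using A unfolding orbit_def by blast
  qed
  \<comment> \<open>Every \<open>d i\<close> divides \<open>L\<close>, so \<open>f a\<close> depends
    only on \<open>a\<close> modulo \<open>L\<close>.\<close>
  also have "\<dots> = (\<lambda>t. f (int t)) ` T"
  proof (intro equalityI subsetI)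
    fix y assume "y \<in> f ` {a. coprime a (int L)}"
    then obtain a where a: "coprime a (int L)" "y = f a" by blast
    obtain t where t: "t \<in> T" "[int t = a] (mod int L)"
      using totative_rep_ex[OF L a(1)] unfolding T_def by blast
    have "pm_rep (d i) (a * int (j i)) = pm_rep (d i) (int t * int (j i))" if i: "i \<in> {1..q}" for i
    proof -
      have "int (d i) dvd int L" using i by (simp add: L_def dvd_Lcm)
      then have "[a = int t] (mod int (d i))" using t(2) by (meson cong_dvd_modulus cong_sym)
      then show ?thesis by (intro pm_rep_cong cong_scalar_right)
    qed
    then have "f a = f (int t)" unfolding f_def by (intro restrict_ext) auto
    then show "y \<in> (\<lambda>t. f (int t)) ` T" using a(2) t(1) by simp
  qed (auto simp: T_def in_totatives_iff)
  finally have orbit: "orbit ?G (unit_act q d) j = (\<lambda>t. f (int t)) ` T" .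
  have fibre: "card {t \<in> T. f (int t) = y} = 2 ^ card (graph_components V (graph_adj V d))"
    if y: "y \<in> (\<lambda>t. f (int t)) ` T" for y
  proof -
    obtain s where s: "s \<in> T" "y = f (int s)" using y by blast
    have sL: "coprime (int s) (int L)" using s(1) by (simp add: T_def in_totatives_iff)
    have "f (int t) = y \<longleftrightarrow>
        (\<forall>i\<in>{1..q}. [int t = int s] (mod int (d i)) \<or> [int t = - int s] (mod int (d i)))"
      if "t \<in> T" for t
    proof -
      have tL: "coprime (int t) (int L)" using that by (simp add: T_def in_totatives_iff)
      have "f (int t) = y \<longleftrightarrow>
          (\<forall>i\<in>{1..q}. pm_rep (d i) (int t * int (j i)) = pm_rep (d i) (int s * int (j i)))"
        unfolding s(2) f_def by (rule restrict_eq_iff)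
      also have "\<dots> \<longleftrightarrow>
        (\<forall>i\<in>{1..q}. [int t = int s] (mod int (d i)) \<or> [int t = - int s] (mod int (d i)))"
      proof (rule ball_cong[OF refl])
        fix i assume i: "i \<in> {1..q}"
        show "pm_rep (d i) (int t * int (j i)) = pm_rep (d i) (int s * int (j i)) \<longleftrightarrow>
          [int t = int s] (mod int (d i)) \<or> [int t = - int s] (mod int (d i))"
          using pos[OF i] by (intro pm_rep_mult_eq_iff cop[OF tL i] cop[OF sL i] jc[OF i]) simp
      qed
      finally show ?thesis .
    qed
    then have "{t \<in> T. f (int t) = y} = {t \<in> totatives L. \<forall>i\<in>{1..q}.
        [int t = int s] (mod int (d i)) \<or> [int t = - int s] (mod int (d i))}"
      by (auto simp: T_def)
    then show ?thesis
      using card_cong_pm_totatives[of q d "int s"] pos sL by (simp add: V_def L_def)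
  qed
  have "totient L = (\<Sum>t\<in>T. 1)" by (simp add: T_def totient_def)
  also have "\<dots> = (\<Sum>y\<in>(\<lambda>t. f (int t)) ` T. card {t \<in> T. f (int t) = y})"
    by (subst sum.image_gen[of T _ "\<lambda>t. f (int t)"]) (simp_all add: T_def)
  also have "\<dots> = card ((\<lambda>t. f (int t)) ` T) * 2 ^ card (graph_components V (graph_adj V d))"
    by (simp add: fibre)
  finally show ?thesis unfolding orbit by (rule sym)
qed

section \<open>Passage to the halved totient and the Betti number\<close>

text \<open>With a vertex present, \<open>L \<ge> 3\<close> and the factor 2 lost in
  \<open>totient_tilde\<close> is the one gained from counting components minus one. With no vertex,
  \<open>L\<close> is 1 or 2, both totients are 1 and both exponents are 0.\<close>

lemma totient_Lcm_eq:
  fixes q :: nat and d :: "nat \<Rightarrow> nat"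
  defines "V \<equiv> graph_verts q d" and "L \<equiv> Lcm (d ` {1..q})"
  assumes pos: "\<And>i. i \<in> {1..q} \<Longrightarrow> d i \<ge> 1"
  shows "real (totient L) * 2 ^ reduced_betti0 V (graph_adj V d)
    = totient_tilde L * 2 ^ card (graph_components V (graph_adj V d))"
proof -
  let ?C = "graph_components V (graph_adj V d)"
  have L: "L > 0" unfolding L_def by (rule Lcm_image_pos) (use pos in auto)
  show ?thesis
  proof (cases "V = {}")
    case True
    have "d i dvd 2" if i: "i \<in> {1..q}" for i
    proof -
      have "\<not> d i \<ge> 3" using True i by (auto simp: V_def graph_verts_def)
      then have "d i = 1 \<or> d i = 2" using pos[OF i] by linarith
      then show ?thesis by auto
    qed
    then have "L dvd 2" unfolding L_def by (intro Lcm_least) auto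
    then have "L \<le> 2" by (simp add: dvd_imp_le)
    then have "L = 1 \<or> L = 2" using L by linarith
    then have "totient L = 1" "totient_tilde L = 1" by (auto simp: totient_tilde_def)
    moreover have "?C = {}" by (simp add: True graph_components_def quotient_def)
    ultimately show ?thesis by (simp add: reduced_betti0_def)
  next
    case False
    then obtain i where i: "i \<in> {1..q}" "d i \<ge> 3" by (auto simp: V_def graph_verts_def)
    have "d i dvd L" using i by (simp add: L_def dvd_Lcm)
    then have "L \<ge> 3" using dvd_imp_le[OF _ L] i(2) by fastforce
    moreover have "finite ?C" unfolding graph_components_def
      by (rule finite_quotient) (auto simp: V_def graph_verts_def)
    moreover have "?C \<noteq> {}" using False by (auto simp: graph_components_def quotient_def)
    ultimately have "card ?C = Suc (reduced_betti0 V (graph_adj V d))"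
      by (simp add: reduced_betti0_def card_gt_0_iff)
    then show ?thesis using \<open>L \<ge> 3\<close> by (simp add: totient_tilde_def)
  qed
qed

theorem theorem1p4:
  fixes q :: nat and d :: "nat \<Rightarrow> nat"
  assumes "\<And>i. i \<in> {1..q} \<Longrightarrow> d i \<ge> 1"
  shows "real (orb q d) =
    (\<Prod>i=1..q. totient_tilde (d i)) / totient_tilde (Lcm (d ` {1..q})) *
    2 ^ reduced_betti0 (graph_verts q d) (graph_adj (graph_verts q d) d)"
proof -
  let ?G = "mod_units (\<Prod>i=1..q. d i)" and ?X = "J_tuples q d" and ?V = "graph_verts q d"
  let ?O = "orbits ?G ?X (unit_act q d)" and ?L = "Lcm (d ` {1..q})"
  define c where "c = card (graph_components ?V (graph_adj ?V d))"
  define \<beta> where "\<beta> = reduced_betti0 ?V (graph_adj ?V d)"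
  interpret group_action ?G ?X "unit_act q d" by (rule unit_act_group_action[OF assms])
  have "card ?X = (\<Sum>Y\<in>?O. card Y)"
    using disjoint_sum[OF finite_J_tuples, of "\<lambda>_. 1::nat"] by simp
  \<comment> \<open>The orbits partition the tuples. The factor \<open>2 ^ c\<close> turns each
    summand into the constant \<open>totient ?L\<close> supplied by
    \<open>card_orbit\<close>.\<close>
  then have "card ?X * 2 ^ c = (\<Sum>Y\<in>?O. card Y * 2 ^ c)" by (simp add: sum_distrib_right)
  also have "\<dots> = (\<Sum>Y\<in>?O. totient ?L)"
    by (rule sum.cong[OF refl]) (use card_orbit[OF assms] in \<open>auto simp: orbits_def c_def\<close>)
  finally have "card ?X * 2 ^ c = orb q d * totient ?L" by (simp add: orb_def)
  then have "real (card ?X) * 2 ^ c = real (orb q d) * real (totient ?L)"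
    by (metis of_nat_mult of_nat_numeral of_nat_power)
  \<comment> \<open>The extra factor \<open>2 ^ \<beta>\<close> prepares for
    \<open>totient_Lcm_eq\<close>, after which \<open>2 ^ c\<close> cancels.\<close>
  then have "real (card ?X) * 2 ^ \<beta> * 2 ^ c = real (orb q d) * (real (totient ?L) * 2 ^ \<beta>)"
    by (simp add: mult_ac)
  also have "real (totient ?L) * 2 ^ \<beta> = totient_tilde ?L * 2 ^ c"
    using totient_Lcm_eq[OF assms] by (simp add: c_def \<beta>_def)
  finally have "real (card ?X) * 2 ^ \<beta> = real (orb q d) * totient_tilde ?L" by simp
  moreover have "?L > 0" by (rule Lcm_image_pos) (use assms in auto)
  then have "totient_tilde ?L > 0" by (simp add: totient_tilde_def)
  ultimately have "real (orb q d) = real (card ?X) / totient_tilde ?L * 2 ^ \<beta>"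
    by (simp add: field_simps)
  then show ?thesis using card_J_tuples[of q d] assms by (simp add: \<beta>_def)
qed

end
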